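(* For every integer $k\geq 3$, there are simple graphs $G$ and $H$, each with $k+3$ vertices, such that $X_G=X_H$ but $\kappa(G)=k$ and $\kappa(H)=k-1$.
   Context: For a finite simple graph $G=(V,E)$, a proper colouring is a function $c:V\to\{1,2,3,\ldots\}$ with $c(u)\neq c(v)$ whenever $\{u,v\}\in E$. The chromatic symmetric function of $G$ is $X_G=\sum_{c\text{ proper}}\prod_{v\in V}x_{c(v)}$, a symmetric function in commuting variables $x_1,x_2,\ldots$. A graph $G=(V,E)$ is $k$-connected if $G$ has at least $k+1$ vertices and for every set of $k-1$ vertices $\{v_1,\ldots,v_{k-1}\}\subset V$, the graph obtained by deleting all of the $v_i$ and all incident edges is connected. The connectivity $\kappa(G)$ is the largest $k$ such that $G$ is $k$-connected. *)

theory Defs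
  imports "Graph_Theory.Digraph_Component" "HOL-Library.Poly_Mapping" "HOL-Library.FuncSet"
begin

text \<open>Finite simple graphs are rendered by \<^locale>\<open>pair_graph\<close>: a finite vertex set together
  with a symmetric, irreflexive set of arcs, the edge \<open>{u, v}\<close> being the pair of arcs
  \<open>(u, v)\<close>, \<open>(v, u)\<close>.\<close>

definition proper_colourings :: "'a pair_pre_digraph \<Rightarrow> ('a \<Rightarrow> nat) set" where
  "proper_colourings G =
     {c \<in> pverts G \<rightarrow>\<^sub>E {1..}. \<forall>(u, v) \<in> parcs G. c u \<noteq> c v}"

text \<open>A monomial in the commuting variables \<open>x\<^sub>1, x\<^sub>2, \<dots>\<close> is represented by its finitely
  supported exponent vector; products of monomials are sums of exponent vectors.\<close>

definition colouring_monomial :: "'a pair_pre_digraph \<Rightarrow> ('a \<Rightarrow> nat) \<Rightarrow> nat \<Rightarrow>\<^sub>0 nat" where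
  "colouring_monomial G c = (\<Sum>v\<in>pverts G. Poly_Mapping.single (c v) 1)"

text \<open>The formal power series \<open>X\<^sub>G\<close>, given by its coefficients: the coefficient of \<open>m\<close> in the
  formal sum of the monomials of all proper colourings is the number of proper colourings
  whose monomial is \<open>m\<close>. This number is finite, see \<open>finite_colourings_of_monomial\<close>.\<close>

definition chromatic_symmetric_function ::
    "'a pair_pre_digraph \<Rightarrow> (nat \<Rightarrow>\<^sub>0 nat) \<Rightarrow> int" where
  "chromatic_symmetric_function G m =
     int (card {c \<in> proper_colourings G. colouring_monomial G c = m})"

lemma finite_colourings_of_monomial:
  assumes "finite (pverts G)"
  shows "finite {c \<in> proper_colourings G. colouring_monomial G c = m}"
proof (rule finite_subset)
  show "{c \<in> proper_colourings G. colouring_monomial G c = m}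
          \<subseteq> pverts G \<rightarrow>\<^sub>E Poly_Mapping.keys m"
  proof
    fix c
    assume c: "c \<in> {c \<in> proper_colourings G. colouring_monomial G c = m}"
    have "c v \<in> Poly_Mapping.keys m" if v: "v \<in> pverts G" for v
    proof -
      have "Poly_Mapping.lookup m (c v)
              = (\<Sum>u\<in>pverts G. Poly_Mapping.lookup (Poly_Mapping.single (c u) 1) (c v))"
        using c by (auto simp: colouring_monomial_def lookup_sum)
      moreover have "\<dots> \<ge> Poly_Mapping.lookup (Poly_Mapping.single (c v) (1::nat)) (c v)"
        using assms v by (intro member_le_sum) auto
      ultimately show ?thesis
        by (auto simp: in_keys_iff)
    qed
    then show "c \<in> pverts G \<rightarrow>\<^sub>E Poly_Mapping.keys m"
      using c by (auto simp: proper_colourings_def PiE_iff)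
  qed
  show "finite (pverts G \<rightarrow>\<^sub>E Poly_Mapping.keys m)"
    using assms by (intro finite_PiE) auto
qed

definition delete_vertices :: "'a pair_pre_digraph \<Rightarrow> 'a set \<Rightarrow> ('a, 'a \<times> 'a) pre_digraph" where
  "delete_vertices G S = with_proj G \<restriction> (pverts G - S)"

text \<open>The condition \<open>card S + 1 = k\<close> says that \<open>S\<close> has \<open>k - 1\<close> elements without truncated
  subtraction; for \<open>k = 0\<close> there is no such set, so every nonempty finite graph is \<open>0\<close>-connected.\<close>

definition k_connected :: "nat \<Rightarrow> 'a pair_pre_digraph \<Rightarrow> bool" where
  "k_connected k G \<longleftrightarrow>
     card (pverts G) \<ge> k + 1 \<and>
     (\<forall>S \<subseteq> pverts G. card S + 1 = k \<longrightarrow> connected (delete_vertices G S))"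

text \<open>For a nonempty finite graph the set below is nonempty and bounded by
  \<open>card (pverts G)\<close>; for the empty graph the value is unspecified.\<close>

definition connectivity :: "'a pair_pre_digraph \<Rightarrow> nat" where
  "connectivity G = (GREATEST k. k_connected k G)"

end

theory Submission
  imports Defs
begin

text \<open>
  Both graphs are described by their complements. Colour classes of a proper colouring of a graph
  are cliques of its complement, so if the complement has no triangle, the chromatic symmetric
  function only records how many matchings of each size the complement has. The 5-cycle with an
  additional isolated vertex, and the path on five vertices with an additional leaf attached to
  its second vertex, have the same numbers of matchings; this remains true after adding \<open>k - 3\<close>
  isolated vertices to each. The complements \<open>G\<close> and \<open>H\<close> of the resulting graphs on \<open>k + 3\<close>
  vertices therefore have the same chromatic symmetric function.

  The equality is proved by a bijection between proper colourings. With the labelling chosen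
  below, both complements arise from the path \<open>5 - 1 - 2 - 3 - 4\<close> by adding one edge: \<open>{4, 5}\<close> closes
  it to a 5-cycle, \<open>{0, 1}\<close> attaches a leaf. A proper colouring of either graph in which the ends
  of the edge added to its complement have different colours is proper for the other graph as
  well. Once \<open>4\<close> and \<open>5\<close> share a colour, the
  other classes can only use the edges \<open>{1, 2}\<close>, \<open>{2, 3}\<close>; once \<open>0\<close> and \<open>1\<close> share one, only \<open>{2, 3}\<close>,
  \<open>{3, 4}\<close>. The reversal \<open>i \<mapsto> 5 - i\<close> exchanges these two situations.

  Neither complement contains a 4-cycle. For such graphs connectivity equals minimum degree
  (lemma \<open>connectivity_eq_min_degree\<close>): a separation into two parts with at least two vertices each
  would give a 4-cycle in the complement, so a separating set must isolate a single vertex and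
  contain all its neighbours. The maximum degrees of the complements are \<open>2\<close> and \<open>3\<close>, so the
  minimum degrees of \<open>G\<close> and \<open>H\<close> are \<open>k\<close> and \<open>k - 1\<close>.
\<close>

section \<open>Connectivity and minimum degree\<close>

lemma connected_delete_vertices_iff:
  assumes "pair_graph G"
  shows "connected (delete_vertices G S) \<longleftrightarrow> pverts G - S \<noteq> {} \<and>
    (\<forall>A B. A \<union> B = pverts G - S \<longrightarrow> A \<inter> B = {} \<longrightarrow> A \<noteq> {} \<longrightarrow> B \<noteq> {} \<longrightarrow>
       (\<exists>a\<in>A. \<exists>b\<in>B. (a, b) \<in> parcs G))"
proof -
  interpret pair_graph G by fact
  define W where "W = pverts G - S"
  define R where "R = {(u, v) \<in> parcs G. u \<in> W \<and> v \<in> W}"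
  have sym: "(v, u) \<in> parcs G" if "(u, v) \<in> parcs G" for u v
    using that pair_sym_arcs by (auto simp: symmetric_def sym_def)
  have "parcs (mk_symmetric (delete_vertices G S)) = R"
    by (auto simp: parcs_mk_symmetric delete_vertices_def R_def W_def intro: sym)
  moreover have "pverts (mk_symmetric (delete_vertices G S)) = W"
    by (simp add: delete_vertices_def W_def)
  ultimately have conn: "connected (delete_vertices G S) \<longleftrightarrow>
      W \<noteq> {} \<and> (\<forall>u\<in>W. \<forall>v\<in>W. (u, v) \<in> rtrancl_on W R)"
    by (simp add: connected_def strongly_connected_def reachable_def)
  have crossing: "\<exists>a\<in>A. \<exists>b\<in>B. (a, b) \<in> parcs G"
    if "\<forall>u\<in>W. \<forall>v\<in>W. (u, v) \<in> rtrancl_on W R" "A \<union> B = W" "A \<inter> B = {}" "A \<noteq> {}" "B \<noteq> {}"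
    for A B
  proof (rule ccontr)
    assume no: "\<not> ?thesis"
    obtain a b where ab: "a \<in> A" "b \<in> B" using \<open>A \<noteq> {}\<close> \<open>B \<noteq> {}\<close> by auto
    have "v \<in> A" if "(a, v) \<in> rtrancl_on W R" for v
      using that ab(1)
    proof (induction rule: rtrancl_on.induct)
      case rtrancl_on_refl
      then show ?case by simp
    next
      case (rtrancl_on_into_rtrancl_on u v)
      with no \<open>A \<union> B = W\<close> show ?case by (auto simp: R_def)
    qed
    with ab that show False by blast
  qed
  have reach: "(u, v) \<in> rtrancl_on W R"
    if cut: "\<And>A B. A \<union> B = W \<Longrightarrow> A \<inter> B = {} \<Longrightarrow> A \<noteq> {} \<Longrightarrow> B \<noteq> {} \<Longrightarrow>
               \<exists>a\<in>A. \<exists>b\<in>B. (a, b) \<in> parcs G"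
      and uv: "u \<in> W" "v \<in> W" for u v
  proof (rule ccontr)
    assume no: "\<not> ?thesis"
    define A where "A = {w \<in> W. (u, w) \<in> rtrancl_on W R}"
    have "u \<in> A" using uv by (auto simp: A_def)
    moreover have "v \<in> W - A" using no uv by (auto simp: A_def)
    ultimately obtain a b where "a \<in> A" "b \<in> W - A" "(a, b) \<in> parcs G"
      using cut[of A "W - A"] unfolding A_def by blast
    then have "(u, b) \<in> rtrancl_on W R"
      by (auto simp: A_def R_def intro: rtrancl_on_into_rtrancl_on)
    with \<open>b \<in> W - A\<close> show False by (auto simp: A_def)
  qed
  show ?thesis
    unfolding conn W_def[symmetric]
  proof (intro iffI conjI allI impI; (elim conjE)?)
    fix A B
    assume "\<forall>u\<in>W. \<forall>v\<in>W. (u, v) \<in> rtrancl_on W R"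
      "A \<union> B = W" "A \<inter> B = {}" "A \<noteq> {}" "B \<noteq> {}"
    then show "\<exists>a\<in>A. \<exists>b\<in>B. (a, b) \<in> parcs G" by (rule crossing)
  next
    assume "\<forall>A B. A \<union> B = W \<longrightarrow> A \<inter> B = {} \<longrightarrow> A \<noteq> {} \<longrightarrow> B \<noteq> {} \<longrightarrow>
              (\<exists>a\<in>A. \<exists>b\<in>B. (a, b) \<in> parcs G)"
    then show "\<forall>u\<in>W. \<forall>v\<in>W. (u, v) \<in> rtrancl_on W R"
      by (intro ballI reach) simp_all
  qed
qed

text \<open>Deleting \<open>k - 1\<close> vertices that include all neighbours of \<open>v\<close>, but not \<open>v\<close> itself, isolates \<open>v\<close>
  from the rest, and the rest is nonempty because at least \<open>k + 1\<close> vertices are present.\<close>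

lemma k_connected_le_degree:
  assumes "pair_graph G" "k_connected k G" "v \<in> pverts G"
  shows "k \<le> card (parcs G `` {v})"
proof (rule ccontr)
  interpret pair_graph G by fact
  assume "\<not> ?thesis"
  then have small: "card (parcs G `` {v}) < k" by simp
  have fin: "finite (pverts G)" by (rule pair_finite_verts)
  have big: "card (pverts G) \<ge> k + 1" using assms by (simp add: k_connected_def)
  have "parcs G `` {v} \<subseteq> pverts G - {v}"
    using pair_no_loops[of "(v, v)"] by (auto dest: in_arcsD2)
  moreover have "card (pverts G - {v}) \<ge> k"
    using big assms(3) fin by simp
  moreover have "card (parcs G `` {v}) \<le> k - 1" "k - 1 \<le> k" using small by auto
  ultimately obtain S where S: "parcs G `` {v} \<subseteq> S" "S \<subseteq> pverts G - {v}" "card S = k - 1"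
    using exists_subset_between[of "parcs G `` {v}" "k - 1" "pverts G - {v}"] fin
    by (meson finite_Diff order_trans)
  have "connected (delete_vertices G S)"
    using assms(2) S small by (auto simp: k_connected_def)
  moreover have "{v} \<union> (pverts G - S - {v}) = pverts G - S" using S assms(3) by auto
  moreover have "pverts G - S - {v} \<noteq> {}"
  proof
    assume "pverts G - S - {v} = {}"
    then have "pverts G - {v} \<subseteq> S" by auto
    then have "k \<le> card S"
      using \<open>card (pverts G - {v}) \<ge> k\<close> S fin by (meson card_mono finite_Diff finite_subset order_trans)
    then show False using S small by simp
  qed
  ultimately have "\<exists>b \<in> pverts G - S - {v}. (v, b) \<in> parcs G"
    using connected_delete_vertices_iff[OF assms(1), of S] by blast
  then show False using S by auto
qed

text \<open>The first hypothesis says that the complement has no 4-cycle \<open>a b a' b'\<close>.\<close>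

lemma connectivity_eq_min_degree:
  assumes G: "pair_graph G"
    and no_C4: "\<And>a a' b b'. {a, a', b, b'} \<subseteq> pverts G \<Longrightarrow> distinct [a, a', b, b'] \<Longrightarrow>
                  {a, a'} \<times> {b, b'} \<inter> parcs G \<noteq> {}"
    and min: "\<And>v. v \<in> pverts G \<Longrightarrow> d \<le> card (parcs G `` {v})"
    and attained: "v \<in> pverts G" "card (parcs G `` {v}) = d"
  shows "connectivity G = d"
  unfolding connectivity_def
proof (rule Greatest_equality)
  interpret pair_graph G by fact
  have fin: "finite (pverts G)" by (rule pair_finite_verts)
  have sym: "(v, u) \<in> parcs G" if "(u, v) \<in> parcs G" for u v
    using that pair_sym_arcs by (auto simp: symmetric_def sym_def)
  have "parcs G `` {v} \<subseteq> pverts G - {v}"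
    using pair_no_loops[of "(v, v)"] by (auto dest: in_arcsD2)
  then have "d \<le> card (pverts G - {v})"
    using attained fin by (metis card_mono finite_Diff)
  then have big: "d + 1 \<le> card (pverts G)"
    using attained(1) fin
    by (metis Suc_eq_plus1 card_Suc_Diff1 Suc_le_mono)
  have "connected (delete_vertices G S)" if S: "S \<subseteq> pverts G" "card S + 1 = d" for S
  proof -
    have finS: "finite S" using S fin finite_subset by blast
    have not_isolated: "\<exists>b \<in> pverts G - S. (a, b) \<in> parcs G" if "a \<in> pverts G" for a
    proof (rule ccontr)
      assume "\<not> ?thesis"
      then have "parcs G `` {a} \<subseteq> S" by (auto dest: in_arcsD2)
      then have "card (parcs G `` {a}) \<le> card S" using finS by (rule card_mono[rotated])
      then show False using min[OF that] S by simp
    qed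
    have "\<exists>a\<in>A. \<exists>b\<in>B. (a, b) \<in> parcs G"
      if AB: "A \<union> B = pverts G - S" "A \<inter> B = {}" "A \<noteq> {}" "B \<noteq> {}" for A B
    proof (rule ccontr)
      assume no: "\<not> ?thesis"
      obtain a b where ab: "a \<in> A" "b \<in> B" using AB by auto
      \<comment> \<open>Each vertex keeps a neighbour after the deletion, which has to lie on its own side, so
        both sides have at least two vertices.\<close>
      obtain a' where a': "a' \<in> A" "(a, a') \<in> parcs G"
        using not_isolated[of a] no ab AB by blast
      obtain b' where b': "b' \<in> B" "(b, b') \<in> parcs G"
        using not_isolated[of b] no ab AB sym by blast
      have "a' \<noteq> a" "b' \<noteq> b" using a' b' pair_no_loops by fastforce+
      then have "{a, a'} \<times> {b, b'} \<inter> parcs G \<noteq> {}"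
        using ab a' b' AB by (intro no_C4) auto
      then show False using no ab a' b' by auto
    qed
    moreover have "pverts G - S \<noteq> {}" using not_isolated[OF attained(1)] by blast
    ultimately show ?thesis using connected_delete_vertices_iff[OF G] by blast
  qed
  then show "k_connected d G" using big by (simp add: k_connected_def)
next
  fix k assume "k_connected k G"
  then show "k \<le> d" using k_connected_le_degree[OF G _ attained(1)] attained(2) by simp
qed

section \<open>Graphs given by their complements\<close>

definition complement_graph :: "nat \<Rightarrow> nat set set \<Rightarrow> nat pair_pre_digraph" where
  "complement_graph n F =
     \<lparr>pverts = {..<n}, parcs = {(u, v). u < n \<and> v < n \<and> u \<noteq> v \<and> {u, v} \<notin> F}\<rparr>"

lemma pverts_complement_graph [simp]: "pverts (complement_graph n F) = {..<n}"
  by (simp add: complement_graph_def)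

lemma parcs_complement_graph:
  "parcs (complement_graph n F) = {(u, v). u < n \<and> v < n \<and> u \<noteq> v \<and> {u, v} \<notin> F}"
  by (simp add: complement_graph_def)

lemma pair_graph_complement_graph: "pair_graph (complement_graph n F)"
proof unfold_locales
  have "parcs (complement_graph n F) \<subseteq> {..<n} \<times> {..<n}"
    by (auto simp: parcs_complement_graph)
  then show "finite (parcs (complement_graph n F))"
    by (rule finite_subset) auto
qed (auto simp: parcs_complement_graph symmetric_def sym_def insert_commute)

lemma proper_colourings_complement_graph:
  "c \<in> proper_colourings (complement_graph n F) \<longleftrightarrow>
     c \<in> {..<n} \<rightarrow>\<^sub>E {1..} \<and> (\<forall>u<n. \<forall>v<n. u \<noteq> v \<longrightarrow> c u = c v \<longrightarrow> {u, v} \<in> F)"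
  by (auto simp: proper_colourings_def parcs_complement_graph)

lemma degree_complement_graph:
  assumes "v < n" "finite N" "N \<subseteq> {..<n} - {v}" "{u. {v, u} \<in> F} \<inter> {..<n} - {v} = N"
  shows "card (parcs (complement_graph n F) `` {v}) = n - 1 - card N"
proof -
  have "parcs (complement_graph n F) `` {v} = {..<n} - {v} - N"
    using assms by (auto simp: parcs_complement_graph)
  then show ?thesis using assms by (simp add: card_Diff_subset)
qed

section \<open>The two graphs\<close>

definition pentagon :: "nat set set" where
  "pentagon = {{1, 2}, {2, 3}, {3, 4}, {4, 5}, {1, 5}}"

definition fork :: "nat set set" where
  "fork = {{0, 1}, {1, 2}, {2, 3}, {3, 4}, {1, 5}}"

definition reversal :: "nat \<Rightarrow> nat" where
  "reversal i = (if i \<le> 5 then 5 - i else i)"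

lemma reversal_reversal [simp]: "reversal (reversal i) = i"
  by (simp add: reversal_def)

lemma reversal_less: "6 \<le> n \<Longrightarrow> reversal i < n \<longleftrightarrow> i < n"
  by (auto simp: reversal_def)

lemma reversal_eq_iff: "reversal i = reversal j \<longleftrightarrow> i = j"
  by (metis reversal_reversal)

lemma reversal_values:
  "reversal 0 = 5" "reversal 1 = 4" "reversal 2 = 3" "reversal 3 = 2" "reversal 4 = 1" "reversal 5 = 0"
  by (simp_all add: reversal_def)

lemma colouring_monomial_reversal:
  assumes "6 \<le> n"
  shows "colouring_monomial (complement_graph n F) (c \<circ> reversal) =
         colouring_monomial (complement_graph n F') c"
proof -
  have "bij_betw reversal {..<n} {..<n}"
    using assms by (intro bij_betw_byWitness[where f' = reversal]) (auto simp: reversal_less)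
  from sum.reindex_bij_betw[OF this, of "\<lambda>v. Poly_Mapping.single (c v) 1"] show ?thesis
    by (simp add: colouring_monomial_def o_def del: One_nat_def)
qed

lemma reversal_PiE:
  assumes "6 \<le> n" "c \<in> {..<n} \<rightarrow>\<^sub>E {1..}"
  shows "c \<circ> reversal \<in> {..<n} \<rightarrow>\<^sub>E {1..}"
  using assms by (auto simp: PiE_iff extensional_def reversal_less)

text \<open>Colour classes are cliques of the complement. A class containing both \<open>4\<close> and \<open>5\<close> contains
  nothing else, because the pentagon has no triangle; so no other class uses an edge at \<open>4\<close>
  or \<open>5\<close>, and the edges still in use are sent into the fork by the reversal. The next lemma is the
  same argument in the opposite direction.\<close>

lemma proper_colourings_pentagon_reversal:
  assumes n: "6 \<le> n" and c: "c \<in> proper_colourings (complement_graph n pentagon)" and "c 4 = c 5"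
  shows "c \<circ> reversal \<in> proper_colourings (complement_graph n fork)"
proof -
  have P: "{u, v} \<in> pentagon" if "u < n" "v < n" "u \<noteq> v" "c u = c v" for u v
    using that c unfolding proper_colourings_complement_graph by blast
  have "c 3 \<noteq> c 5" "c 1 \<noteq> c 4"
    using P[of 3 5] P[of 1 4] n by (auto simp: pentagon_def doubleton_eq_iff)
  then have "c 3 \<noteq> c 4" "c 1 \<noteq> c 5" using \<open>c 4 = c 5\<close> by auto
  have "{u, v} \<in> fork" if "u < n" "v < n" "u \<noteq> v" "c (reversal u) = c (reversal v)" for u v
  proof -
    have "{reversal u, reversal v} \<in> pentagon"
      using that by (intro P) (simp_all add: reversal_less[OF n] reversal_eq_iff)
    moreover have "{reversal u, reversal v} \<noteq> {3, 4}" "{reversal u, reversal v} \<noteq> {1, 5}"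
      using that(4) \<open>c 3 \<noteq> c 4\<close> \<open>c 1 \<noteq> c 5\<close> by (metis doubleton_eq_iff)+
    ultimately have "{reversal u, reversal v} \<in> {{1, 2}, {2, 3}, {4, 5}}"
      unfolding pentagon_def insert_iff by argo
    moreover have "{u, v} = reversal ` {reversal u, reversal v}" by simp
    ultimately have "{u, v} \<in> (`) reversal ` {{1, 2}, {2, 3}, {4, 5}}" by blast
    also have "(`) reversal ` {{1, 2}, {2, 3}, {4, 5}} = {{4, 3}, {3, 2}, {1, 0}}"
      by (simp only: image_insert image_empty reversal_values)
    also have "\<dots> \<subseteq> fork"
      by (simp add: fork_def doubleton_eq_iff)
    finally show ?thesis .
  qed
  moreover have "c \<circ> reversal \<in> {..<n} \<rightarrow>\<^sub>E {1..}"
    using c reversal_PiE[OF n] unfolding proper_colourings_complement_graph by blast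
  ultimately show ?thesis
    unfolding proper_colourings_complement_graph o_apply by blast
qed

lemma proper_colourings_fork_reversal:
  assumes n: "6 \<le> n" and c: "c \<in> proper_colourings (complement_graph n fork)" and "c 0 = c 1"
  shows "c \<circ> reversal \<in> proper_colourings (complement_graph n pentagon)"
proof -
  have P: "{u, v} \<in> fork" if "u < n" "v < n" "u \<noteq> v" "c u = c v" for u v
    using that c unfolding proper_colourings_complement_graph by blast
  have "c 0 \<noteq> c 2" "c 0 \<noteq> c 5"
    using P[of 0 2] P[of 0 5] n by (auto simp: fork_def doubleton_eq_iff)
  then have "c 1 \<noteq> c 2" "c 1 \<noteq> c 5" using \<open>c 0 = c 1\<close> by auto
  have "{u, v} \<in> pentagon" if "u < n" "v < n" "u \<noteq> v" "c (reversal u) = c (reversal v)" for u v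
  proof -
    have "{reversal u, reversal v} \<in> fork"
      using that by (intro P) (simp_all add: reversal_less[OF n] reversal_eq_iff)
    moreover have "{reversal u, reversal v} \<noteq> {1, 2}" "{reversal u, reversal v} \<noteq> {1, 5}"
      using that(4) \<open>c 1 \<noteq> c 2\<close> \<open>c 1 \<noteq> c 5\<close> by (metis doubleton_eq_iff)+
    ultimately have "{reversal u, reversal v} \<in> {{0, 1}, {2, 3}, {3, 4}}"
      unfolding fork_def insert_iff by argo
    moreover have "{u, v} = reversal ` {reversal u, reversal v}" by simp
    ultimately have "{u, v} \<in> (`) reversal ` {{0, 1}, {2, 3}, {3, 4}}" by blast
    also have "(`) reversal ` {{0, 1}, {2, 3}, {3, 4}} = {{5, 4}, {3, 2}, {2, 1}}"
      by (simp only: image_insert image_empty reversal_values)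
    also have "\<dots> \<subseteq> pentagon"
      by (simp add: pentagon_def doubleton_eq_iff)
    finally show ?thesis .
  qed
  moreover have "c \<circ> reversal \<in> {..<n} \<rightarrow>\<^sub>E {1..}"
    using c reversal_PiE[OF n] unfolding proper_colourings_complement_graph by blast
  ultimately show ?thesis
    unfolding proper_colourings_complement_graph o_apply by blast
qed

lemma pentagon_fork_agree:
  "{u, v} \<noteq> {4, 5} \<Longrightarrow> {u, v} \<noteq> {0, 1} \<Longrightarrow> {u, v} \<in> pentagon \<longleftrightarrow> {u, v} \<in> fork"
  by (auto simp: pentagon_def fork_def)

lemma pentagon_fork_extra_edge:
  "{0, 1} \<notin> pentagon" "{4, 5} \<notin> fork"
  by (auto simp: pentagon_def fork_def doubleton_eq_iff)

text \<open>Without the two extra edges the complements coincide.\<close>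

lemma proper_colourings_pentagon_iff_fork:
  assumes "c 4 \<noteq> c 5" "c 0 \<noteq> c 1"
  shows "c \<in> proper_colourings (complement_graph n pentagon) \<longleftrightarrow>
         c \<in> proper_colourings (complement_graph n fork)"
proof -
  have "{u, v} \<in> pentagon \<longleftrightarrow> {u, v} \<in> fork" if "c u = c v" for u v
    using that assms by (intro pentagon_fork_agree) (metis doubleton_eq_iff)+
  then show ?thesis unfolding proper_colourings_complement_graph by blast
qed

lemma chromatic_symmetric_function_pentagon_fork:
  assumes n: "6 \<le> n"
  shows "chromatic_symmetric_function (complement_graph n pentagon) =
         chromatic_symmetric_function (complement_graph n fork)"
proof
  fix m
  let ?P = "{c \<in> proper_colourings (complement_graph n pentagon).
              colouring_monomial (complement_graph n pentagon) c = m}"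
  let ?Q = "{c \<in> proper_colourings (complement_graph n fork).
              colouring_monomial (complement_graph n fork) c = m}"
  define f where "f c = (if c 4 = c 5 then c \<circ> reversal else c)" for c :: "nat \<Rightarrow> nat"
  define g where "g c = (if c 0 = c 1 then c \<circ> reversal else c)" for c :: "nat \<Rightarrow> nat"
  have diff01: "c 0 \<noteq> c 1" if "c \<in> ?P" for c
  proof -
    have "\<forall>u<n. \<forall>v<n. u \<noteq> v \<longrightarrow> c u = c v \<longrightarrow> {u, v} \<in> pentagon"
      using that unfolding mem_Collect_eq proper_colourings_complement_graph by blast
    from this[rule_format, of 0 1] n show ?thesis using pentagon_fork_extra_edge(1) by auto
  qed
  have diff45: "c 4 \<noteq> c 5" if "c \<in> ?Q" for c
  proof -
    have "\<forall>u<n. \<forall>v<n. u \<noteq> v \<longrightarrow> c u = c v \<longrightarrow> {u, v} \<in> fork"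
      using that unfolding mem_Collect_eq proper_colourings_complement_graph by blast
    from this[rule_format, of 4 5] n show ?thesis using pentagon_fork_extra_edge(2) by auto
  qed
  have rr: "c \<circ> reversal \<circ> reversal = c" for c :: "nat \<Rightarrow> nat"
    by (auto simp: fun_eq_iff)
  have same: "colouring_monomial (complement_graph n pentagon) c =
              colouring_monomial (complement_graph n fork) c" for c
    by (simp add: colouring_monomial_def)
  have "f c \<in> ?Q" if "c \<in> ?P" for c
    using that diff01[OF that] proper_colourings_pentagon_reversal[OF n, of c]
      proper_colourings_pentagon_iff_fork[of c n]
      colouring_monomial_reversal[OF n, of fork c fork]
    by (auto simp: f_def same)
  moreover have "g c \<in> ?P" if "c \<in> ?Q" for c
    using that diff45[OF that] proper_colourings_fork_reversal[OF n, of c]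
      proper_colourings_pentagon_iff_fork[of c n]
      colouring_monomial_reversal[OF n, of fork c fork]
    by (auto simp: g_def same)
  moreover have "g (f c) = c" if "c \<in> ?P" for c
    using diff01[OF that] by (auto simp: f_def g_def reversal_values[unfolded One_nat_def] rr)
  moreover have "f (g c) = c" if "c \<in> ?Q" for c
    using diff45[OF that] by (auto simp: f_def g_def reversal_values rr)
  ultimately have "bij_betw f ?P ?Q"
    by (intro bij_betw_byWitness[where f' = g]) blast+
  then show "chromatic_symmetric_function (complement_graph n pentagon) m =
             chromatic_symmetric_function (complement_graph n fork) m"
    unfolding chromatic_symmetric_function_def by (simp add: bij_betw_same_card)
qed

lemma neighbours_pentagon:
  "{u. {v, u} \<in> pentagon} =
     (if v = 1 then {2, 5} else if v = 2 then {1, 3} else if v = 3 then {2, 4}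
      else if v = 4 then {3, 5} else if v = 5 then {1, 4} else {})"
  by (auto simp: pentagon_def doubleton_eq_iff)

lemma neighbours_fork:
  "{u. {v, u} \<in> fork} =
     (if v = 0 then {1} else if v = 1 then {0, 2, 5} else if v = 2 then {1, 3}
      else if v = 3 then {2, 4} else if v = 4 then {3} else if v = 5 then {1} else {})"
  by (auto simp: fork_def doubleton_eq_iff)

lemma pentagon_no_4_cycle:
  assumes "{a, b} \<in> pentagon" "{a, b'} \<in> pentagon" "{b, a'} \<in> pentagon" "{b', a'} \<in> pentagon" "b \<noteq> b'"
  shows "a = a'"
proof -
  have adj: "b \<in> {u. {a, u} \<in> pentagon}" "b' \<in> {u. {a, u} \<in> pentagon}"
    "a' \<in> {u. {b, u} \<in> pentagon}" "a' \<in> {u. {b', u} \<in> pentagon}"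
    using assms by auto
  have "a \<in> {1, 2, 3, 4, 5}"
    using adj(1) unfolding neighbours_pentagon by (auto split: if_splits)
  then show ?thesis
    using adj \<open>b \<noteq> b'\<close> unfolding neighbours_pentagon insert_iff empty_iff
    by (elim disjE) auto
qed

lemma fork_no_4_cycle:
  assumes "{a, b} \<in> fork" "{a, b'} \<in> fork" "{b, a'} \<in> fork" "{b', a'} \<in> fork" "b \<noteq> b'"
  shows "a = a'"
proof -
  have adj: "b \<in> {u. {a, u} \<in> fork}" "b' \<in> {u. {a, u} \<in> fork}"
    "a' \<in> {u. {b, u} \<in> fork}" "a' \<in> {u. {b', u} \<in> fork}"
    using assms by auto
  have "a \<in> {0, 1, 2, 3, 4, 5}"
    using adj(1) unfolding neighbours_fork by (auto split: if_splits)
  then show ?thesis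
    using adj \<open>b \<noteq> b'\<close> unfolding neighbours_fork insert_iff empty_iff
    by (elim disjE) auto
qed

lemma connectivity_pentagon:
  assumes n: "6 \<le> n"
  shows "connectivity (complement_graph n pentagon) = n - 3"
proof (rule connectivity_eq_min_degree[OF pair_graph_complement_graph])
  fix a a' b b' :: nat
  assume "{a, a', b, b'} \<subseteq> pverts (complement_graph n pentagon)" "distinct [a, a', b, b']"
  moreover have "\<not> ({a, b} \<in> pentagon \<and> {a, b'} \<in> pentagon \<and> {b, a'} \<in> pentagon \<and> {b', a'} \<in> pentagon)"
    using \<open>distinct [a, a', b, b']\<close> pentagon_no_4_cycle by auto
  ultimately show "{a, a'} \<times> {b, b'} \<inter> parcs (complement_graph n pentagon) \<noteq> {}"
    by (auto simp: parcs_complement_graph insert_commute)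
next
  fix v assume "v \<in> pverts (complement_graph n pentagon)"
  then have "card (parcs (complement_graph n pentagon) `` {v}) = n - 1 - card {u. {v, u} \<in> pentagon}"
    using n by (intro degree_complement_graph) (auto simp: neighbours_pentagon)
  moreover have "card {u. {v, u} \<in> pentagon} \<le> 2" by (simp add: neighbours_pentagon)
  ultimately show "n - 3 \<le> card (parcs (complement_graph n pentagon) `` {v})" by simp
next
  show "1 \<in> pverts (complement_graph n pentagon)" using n by simp
  have "card (parcs (complement_graph n pentagon) `` {1}) = n - 1 - card {2, 5 :: nat}"
    using n by (intro degree_complement_graph) (auto simp: neighbours_pentagon)
  then show "card (parcs (complement_graph n pentagon) `` {1}) = n - 3" by simp
qed

lemma connectivity_fork:
  assumes n: "6 \<le> n"
  shows "connectivity (complement_graph n fork) = n - 4"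
proof (rule connectivity_eq_min_degree[OF pair_graph_complement_graph])
  fix a a' b b' :: nat
  assume "{a, a', b, b'} \<subseteq> pverts (complement_graph n fork)" "distinct [a, a', b, b']"
  moreover have "\<not> ({a, b} \<in> fork \<and> {a, b'} \<in> fork \<and> {b, a'} \<in> fork \<and> {b', a'} \<in> fork)"
    using \<open>distinct [a, a', b, b']\<close> fork_no_4_cycle by auto
  ultimately show "{a, a'} \<times> {b, b'} \<inter> parcs (complement_graph n fork) \<noteq> {}"
    by (auto simp: parcs_complement_graph insert_commute)
next
  fix v assume "v \<in> pverts (complement_graph n fork)"
  then have "card (parcs (complement_graph n fork) `` {v}) = n - 1 - card {u. {v, u} \<in> fork}"
    using n by (intro degree_complement_graph) (auto simp: neighbours_fork)
  moreover have "card {u. {v, u} \<in> fork} \<le> 3" by (simp add: neighbours_fork)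
  ultimately show "n - 4 \<le> card (parcs (complement_graph n fork) `` {v})" by simp
next
  show "1 \<in> pverts (complement_graph n fork)" using n by simp
  have "card (parcs (complement_graph n fork) `` {1}) = n - 1 - card {0, 2, 5 :: nat}"
    using n by (intro degree_complement_graph) (auto simp: neighbours_fork)
  then show "card (parcs (complement_graph n fork) `` {1}) = n - 4" by simp
qed

theorem corollary3p8:
  fixes k :: nat
  assumes "k \<ge> 3"
  shows "\<exists>(G :: nat pair_pre_digraph) (H :: nat pair_pre_digraph).
           pair_graph G \<and> pair_graph H \<and>
           card (pverts G) = k + 3 \<and> card (pverts H) = k + 3 \<and>
           chromatic_symmetric_function G = chromatic_symmetric_function H \<and>
           connectivity G = k \<and> connectivity H = k - 1"
proof (intro exI conjI)
  let ?G = "complement_graph (k + 3) pentagon"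
  let ?H = "complement_graph (k + 3) fork"
  show "pair_graph ?G" "pair_graph ?H" by (rule pair_graph_complement_graph)+
  show "card (pverts ?G) = k + 3" "card (pverts ?H) = k + 3" by simp_all
  show "chromatic_symmetric_function ?G = chromatic_symmetric_function ?H"
    using assms by (intro chromatic_symmetric_function_pentagon_fork) simp
  show "connectivity ?G = k" using connectivity_pentagon[of "k + 3"] assms by simp
  show "connectivity ?H = k - 1" using connectivity_fork[of "k + 3"] assms by simp
qed

end
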